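(* Let $P^{\times}_{2,3}(x,y)=1+y+xy+xy^2+xy^3+x^2y^3+x^2y^4$. For each positive integer $n$, regard $P^{\times}_{2,3}(x,x^n)$ as a polynomial in the single variable $x$, and let $C(P^{\times}_{2,3}(x,x^n))$ be the ratio of the number of its complex zeros (counted with multiplicity) of modulus different from $1$ to its degree. Then the limit as $n\to\infty$ exists and $$\lim_{n\to \infty}C(P^{\times}_{2,3}(x,x^n))=\frac{1}{\pi}\arccos\frac{3}{4}\quad(\approx 0.230053456).$$
   Context: For a nonconstant polynomial $P(x)\in\mathbb{C}[x]$ of degree $d$, let $I(P)$ denote the number of complex zeros of $P$ with modulus $<1$, and $O(P)$ the number of complex zeros of $P$ with modulus $>1$, both counted with multiplicity. Define $C(P)=\dfrac{I(P)+O(P)}{d}$. *)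

theory Defs
  imports "HOL-Analysis.Analysis" "HOL-Computational_Algebra.Computational_Algebra"
begin

definition num_inside :: "complex poly \<Rightarrow> nat" where
  "num_inside p = size {#z \<in># proots p. norm z < 1#}"

definition num_outside :: "complex poly \<Rightarrow> nat" where
  "num_outside p = size {#z \<in># proots p. norm z > 1#}"

definition off_circle_ratio :: "complex poly \<Rightarrow> real" where
  "off_circle_ratio p = real (num_inside p + num_outside p) / real (degree p)"

text \<open>
  Polynomials in \<open>x\<close> and \<open>y\<close> are represented as polynomials in \<open>y\<close> whose coefficients are
  polynomials in \<open>x\<close>. Substituting a polynomial \<open>q\<close> in \<open>x\<close> for \<open>y\<close> is then \<open>poly P q\<close>.
\<close>

definition P23 :: "complex poly poly" where
  "P23 = (let x = [:[:0, 1:]:]; y = [:0, 1:] in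
     1 + y + x * y + x * y ^ 2 + x * y ^ 3 + x ^ 2 * y ^ 3 + x ^ 2 * y ^ 4)"

end

theory Submission
  imports Defs
begin

text \<open>
  Write \<open>p\<close> for \<open>P\<^sup>\<times>\<^sub>2\<^sub>,\<^sub>3(x, x\<^sup>n)\<close> and \<open>m = 2n + 1\<close>, so that \<open>p\<close> has degree \<open>2m\<close>. The polynomial is
  self-reciprocal; hence on the unit circle, with \<open>x = e\<^sup>2\<^sup>i\<^sup>t\<close>, it is the unimodular factor \<open>e\<^sup>2\<^sup>i\<^sup>m\<^sup>t\<close>
  times a real function, and this function is
  \<open>f(t) = 4 c\<^sup>2 + 4 c cos t - 1\<close> with \<open>c = cos (m t)\<close>. Replacing \<open>t\<close> by \<open>t + \<pi>\<close> fixes \<open>x\<close> and flips the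
  sign of \<open>c\<close>, and \<open>c = 0\<close> is impossible at a zero of \<open>f\<close>. So the zeros of \<open>p\<close> on the unit circle
  correspond one to one to the zeros \<open>t \<in> (-\<pi>, \<pi>)\<close> of \<open>f\<close> with \<open>c > 0\<close>
  (lemmas \<open>unit_root_lift\<close> and \<open>unit_root_lift_unique\<close>).

  The condition \<open>c > 0\<close> cuts the \<open>t\<close>-axis into windows \<open>\<bar>m t - 2 \<pi> k\<bar> < \<pi>/2\<close>. In each of
  them \<open>f = -4 c K\<close> with \<open>K = 1/(4c) - c - cos t\<close>, and \<open>K\<close> is strictly convex, because the first
  two terms contribute at least \<open>m\<^sup>2\<close> to the second derivative and the last one at least \<open>-1\<close>.
  So a window holds at most two zeros, counted with multiplicity
  (\<open>sum_order_window_le_two\<close>). If \<open>cos (2 \<pi> k / m) > -3/4\<close> then \<open>f\<close> is positive in the centre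
  of the window and equals \<open>-1\<close> at both ends, which forces two zeros
  (\<open>profile_zero_exists\<close>); conversely a zero needs \<open>cos t = 1/(4c) - c \<ge> -3/4\<close> since
  \<open>0 < c \<le> 1\<close>.

  Thus, up to a bounded error, the number of zeros on the circle is twice the number of \<open>k\<close> with
  \<open>\<bar>2 \<pi> k / m\<bar> < arccos (-3/4)\<close>, that is \<open>2 m arccos (-3/4) / \<pi>\<close>
  (\<open>unit_root_count_upper\<close> and \<open>unit_root_count_lower\<close>). Dividing by \<open>2m\<close>, the proportion of
  zeros off the circle is \<open>1 - arccos (-3/4) / \<pi> = arccos (3/4) / \<pi>\<close> up to \<open>O(1/n)\<close>.
\<close>

section \<open>Zeros on the unit circle and their multiplicities\<close>

lemma num_inside_outside_eq:
  assumes "p \<noteq> 0"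
  shows "num_inside p + num_outside p + (\<Sum>z | poly p z = 0 \<and> norm z = 1. order z p) = degree p"
proof -
  have "size (proots p) = num_inside p + num_outside p + size {#z \<in># proots p. norm z = 1#}"
  proof -
    have "proots p = {#z \<in># proots p. norm z < 1#} + {#z \<in># proots p. norm z > 1#}
        + {#z \<in># proots p. norm z = 1#}"
      by (rule multiset_eqI) auto
    then show ?thesis
      unfolding num_inside_def num_outside_def by (metis size_union)
  qed
  moreover have "size {#z \<in># proots p. norm z = 1#} = (\<Sum>z | poly p z = 0 \<and> norm z = 1. order z p)"
    unfolding size_multiset_overloaded_eq using assms
    by (intro sum.cong) auto
  ultimately show ?thesis
    using size_proots_complex[of p] by simp
qed

text \<open>
  For \<open>x = e\<^sup>2\<^sup>i\<^sup>t\<close> the \<open>t\<close>-derivative of \<open>e\<^sup>-\<^sup>i\<^sup>c\<^sup>t p(x)\<close> is \<open>e\<^sup>-\<^sup>i\<^sup>c\<^sup>t q(x)\<close> for the polynomial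
  \<open>q = i (2 x p' - c p)\<close>. Keeping the result in the same shape lets differentiation be repeated, and
  turns the order of a root of \<open>p\<close> into vanishing derivatives of a real function.
\<close>

definition angular_pderiv :: "complex \<Rightarrow> complex poly \<Rightarrow> complex poly" where
  "angular_pderiv c p = smult \<i> ([:0, 2:] * pderiv p - smult c p)"

lemma power_dvd_angular_pderiv:
  assumes "[:- a, 1:] ^ Suc k dvd p"
  shows "[:- a, 1:] ^ k dvd angular_pderiv c p"
proof -
  from assms obtain r where r: "p = [:- a, 1:] ^ Suc k * r" by (rule dvdE)
  have "[:- a, 1:] ^ k dvd p"
    unfolding r power_Suc2 mult.assoc by (rule dvd_triv_left)
  moreover have "[:- a, 1:] ^ k dvd pderiv p"
    unfolding r pderiv_mult pderiv_power_Suc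
    by (rule dvd_add[OF dvd_mult2[OF le_imp_power_dvd]
          dvd_mult[OF dvd_mult2[OF dvd_smult[OF dvd_refl]]]]) simp
  ultimately show ?thesis
    unfolding angular_pderiv_def by (intro dvd_smult dvd_diff dvd_mult)
qed

lemma angular_derivative:
  fixes g :: "real \<Rightarrow> real"
  assumes g: "\<And>t. complex_of_real (g t) = cis (- (c * t)) * poly p (cis (2 * t))"
    and d: "(g has_real_derivative g') (at t)"
  shows "complex_of_real g' = cis (- (c * t)) * poly (angular_pderiv (of_real c) p) (cis (2 * t))"
proof -
  define G where "G = (\<lambda>z. exp (- (\<i> * of_real c * z)) * poly p (exp (2 * \<i> * z)))"
  have G: "G (of_real t) = of_real (g t)" for t
    unfolding g G_def cis_conv_exp by (simp add: mult_ac)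
  have "(G has_field_derivative
      exp (- (\<i> * of_real c * of_real t)) * poly (angular_pderiv (of_real c) p) (exp (2 * \<i> * of_real t)))
      (at (of_real t))"
    unfolding G_def angular_pderiv_def
    by (auto intro!: derivative_eq_intros poly_DERIV[THEN DERIV_chain2] simp: algebra_simps)
  from has_vector_derivative_real_field[OF this]
  have "((\<lambda>t. complex_of_real (g t)) has_vector_derivative
      exp (- (\<i> * of_real c * of_real t)) * poly (angular_pderiv (of_real c) p) (exp (2 * \<i> * of_real t)))
      (at t)"
    by (simp add: G)
  moreover have "((\<lambda>t. complex_of_real (g t)) has_vector_derivative of_real g') (at t)"
    using d by (intro has_vector_derivative_of_real)
      (simp add: has_real_derivative_iff_has_vector_derivative)
  ultimately show ?thesis
    by (auto dest: vector_derivative_unique_at simp: cis_conv_exp mult_ac)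
qed

section \<open>Zeros of a strictly convex function\<close>

text \<open>
  By Rolle, three zeros of \<open>K\<close>, or two zeros one of which is also a zero of \<open>K'\<close>, would give
  two zeros of the strictly increasing \<open>K'\<close>. The weight \<open>ord\<close> stands for a multiplicity, of which
  only its relation to \<open>K'\<close> matters; this allows the multiplicity to be that of a root of a
  complex polynomial rather than of \<open>K\<close> itself.
\<close>

lemma sum_le_two_of_convex:
  fixes K K' K'' :: "real \<Rightarrow> real" and ord :: "real \<Rightarrow> nat"
  assumes K: "\<And>t. t \<in> {a<..<b} \<Longrightarrow> (K has_real_derivative K' t) (at t)"
    and K': "\<And>t. t \<in> {a<..<b} \<Longrightarrow> (K' has_real_derivative K'' t) (at t)"
    and pos: "\<And>t. t \<in> {a<..<b} \<Longrightarrow> K'' t > 0"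
    and Z: "finite Z" "Z \<subseteq> {a<..<b}" "\<And>t. t \<in> Z \<Longrightarrow> K t = 0"
    and ord2: "\<And>t. t \<in> Z \<Longrightarrow> ord t \<le> 2"
    and ord1: "\<And>t. t \<in> Z \<Longrightarrow> K' t \<noteq> 0 \<Longrightarrow> ord t \<le> 1"
  shows "sum ord Z \<le> 2"
proof -
  have less: "K' u < K' v" if "u < v" "u \<in> {a<..<b}" "v \<in> {a<..<b}" for u v
  proof (rule DERIV_pos_imp_increasing[OF that(1)])
    fix x assume "u \<le> x" "x \<le> v"
    with that have "x \<in> {a<..<b}" by auto
    then show "\<exists>y. (K' has_real_derivative y) (at x) \<and> y > 0" using K' pos by blast
  qed
  have rolle: "\<exists>x. u < x \<and> x < v \<and> K' x = 0" if "u < v" "u \<in> Z" "v \<in> Z" for u v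
  proof -
    have sub: "x \<in> {a<..<b}" if "u \<le> x" "x \<le> v" for x
      using that \<open>u \<in> Z\<close> \<open>v \<in> Z\<close> Z(2) by force
    obtain x where "u < x" "x < v" "K v - K u = (v - u) * K' x"
      using MVT2[OF \<open>u < v\<close>, of K K'] K sub by blast
    then show ?thesis using that Z(3) by auto
  qed
  show ?thesis
  proof (cases "\<exists>z\<in>Z. K' z = 0")
    case True
    then obtain z where z: "z \<in> Z" "K' z = 0" by blast
    have "w = z" if w: "w \<in> Z" for w
    proof (rule ccontr)
      assume "w \<noteq> z"
      then obtain x where x: "K' x = 0" "(w < x \<and> x < z) \<or> (z < x \<and> x < w)"
        using rolle[of w z] rolle[of z w] w z(1) \<open>w \<noteq> z\<close> by (cases w z rule: linorder_cases) auto
      have "x \<in> {a<..<b}" "z \<in> {a<..<b}" using x(2) w z(1) Z(2) by force+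
      then show False using less[of x z] less[of z x] x z(2) by force
    qed
    then have "Z = {z}" using z(1) by blast
    then show ?thesis using ord2 by simp
  next
    case False
    have "card Z \<le> 2"
    proof (rule ccontr)
      assume c: "\<not> card Z \<le> 2"
      then have ne: "Z \<noteq> {}" by auto
      have "card {Min Z, Max Z} \<le> 2" by (simp add: card_insert_if)
      then have "\<not> Z \<subseteq> {Min Z, Max Z}"
        using c card_mono[of "{Min Z, Max Z}" Z] by auto
      then obtain y where y: "y \<in> Z" "y \<noteq> Min Z" "y \<noteq> Max Z" by auto
      have "Min Z < y" "y < Max Z" using y Z(1)
        by (metis Min_le order_le_less) (metis y Max_ge Z(1) order_le_less)
      moreover have mem: "Min Z \<in> Z" "Max Z \<in> Z" using Z(1) ne by auto
      ultimately obtain u v where uv: "Min Z < u" "u < y" "K' u = 0" "y < v" "v < Max Z" "K' v = 0"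
        using rolle[OF _ mem(1) y(1)] rolle[OF _ y(1) mem(2)] by auto
      have "u \<in> {a<..<b}" "v \<in> {a<..<b}"
        using uv \<open>Min Z \<in> Z\<close> \<open>Max Z \<in> Z\<close> y(1) Z(2) by force+
      with less[of u v] uv show False by simp
    qed
    moreover have "sum ord Z \<le> (\<Sum>z\<in>Z. 1)" using ord1 False by (intro sum_mono) auto
    ultimately show ?thesis by simp
  qed
qed

section \<open>Windows on which the cosine is positive\<close>

lemma cos_pos_window:
  fixes x :: real
  assumes "cos x > 0"
  obtains k :: int where "\<bar>x - 2 * pi * of_int k\<bar> < pi / 2"
proof -
  define k where "k = round (x / (2 * pi))"
  define y where "y = x - 2 * pi * of_int k"
  have "\<bar>x / (2 * pi) - of_int k\<bar> \<le> 1/2"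
    unfolding k_def using of_int_round_abs_le[of "x / (2*pi)"] by (simp add: abs_minus_commute)
  then have "\<bar>y\<bar> \<le> pi"
    unfolding y_def by (auto simp: abs_le_iff field_simps)
  have "cos x = cos y"
    unfolding y_def using cos_int_2pin[of k] sin_int_2pin[of k] by (simp add: cos_diff)
  then have "cos \<bar>y\<bar> > 0" using assms by simp
  have "\<bar>y\<bar> < pi / 2"
  proof (rule ccontr)
    assume "\<not> \<bar>y\<bar> < pi / 2"
    then have "cos \<bar>y\<bar> \<le> cos (pi / 2)"
      using \<open>\<bar>y\<bar> \<le> pi\<close> by (subst cos_mono_le_eq) auto
    then show False using \<open>cos \<bar>y\<bar> > 0\<close> by simp
  qed
  then show ?thesis using that y_def by blast
qed

lemma cos_window_pos:
  fixes x :: real and k :: int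
  assumes "\<bar>x - 2 * pi * of_int k\<bar> < pi / 2"
  shows "cos x > 0"
proof -
  have "cos (x - 2 * pi * of_int k) > 0"
    by (rule cos_gt_zero_pi) (use assms in linarith)+
  then show ?thesis
    using cos_int_2pin[of k] sin_int_2pin[of k] by (simp add: cos_diff)
qed

lemma card_abs_less:
  fixes B :: real
  assumes "B > 0"
  shows "finite {k::int. \<bar>of_int k\<bar> < B}"
    and "2 * B - 1 \<le> card {k::int. \<bar>of_int k\<bar> < B}"
    and "card {k::int. \<bar>of_int k\<bar> < B} \<le> 2 * B + 1"
proof -
  have eq: "{k::int. \<bar>of_int k\<bar> < B} = {- \<lceil>B\<rceil> + 1 .. \<lceil>B\<rceil> - 1}"
    by (auto simp: abs_less_iff) linarith+
  have "\<lceil>B\<rceil> \<ge> 1" using assms by linarith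
  then have "real (card {k::int. \<bar>of_int k\<bar> < B}) = 2 * of_int \<lceil>B\<rceil> - 1"
    unfolding eq by simp
  then show "2 * B - 1 \<le> card {k::int. \<bar>of_int k\<bar> < B}"
    and "card {k::int. \<bar>of_int k\<bar> < B} \<le> 2 * B + 1" by linarith+
  show "finite {k::int. \<bar>of_int k\<bar> < B}" unfolding eq by simp
qed

section \<open>The polynomial on the unit circle\<close>

lemma poly_P23_monom:
  "poly P23 (monom 1 n) = monom 1 0 + monom 1 n + monom 1 (n + 1) + monom 1 (2 * n + 1)
     + monom 1 (3 * n + 1) + monom 1 (3 * n + 2) + monom 1 (4 * n + 2)"
proof -
  have x: "[:0, 1:] = (monom 1 1 :: complex poly)" by (simp add: monom_altdef)
  show ?thesis
    unfolding P23_def Let_def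
    by (simp add: x monom_power mult_monom one_pCons monom_0 algebra_simps)
qed

lemma degree_P23_monom:
  assumes "n > 0"
  shows "degree (poly P23 (monom 1 n)) = 4 * n + 2"
  unfolding poly_P23_monom using assms
  by (subst degree_add_eq_right)
    (auto simp: degree_monom_eq intro!: le_less_trans[OF degree_add_le_max] order_le_less_trans[OF degree_monom_le])

definition profile :: "real \<Rightarrow> real \<Rightarrow> real" where
  "profile m t = 4 * cos (m * t) ^ 2 + 4 * cos t * cos (m * t) - 1"

lemma cis_mult_cos: "cis b * complex_of_real (2 * cos a) = cis (b + a) + cis (b - a)"
  by (simp add: complex_eq_iff cos_add cos_diff sin_add sin_diff algebra_simps)

text \<open>
  The seven exponents are symmetric about \<open>2 n + 1 = m\<close>, so after division by \<open>x\<^sup>m\<close> they pair up to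
  cosines of \<open>2 m t\<close>, \<open>(m + 1) t\<close> and \<open>(m - 1) t\<close>; the last two combine to the product
  \<open>cos t cos (m t)\<close>.
\<close>

lemma poly_P23_cis:
  fixes n :: nat
  defines "m \<equiv> real (2 * n + 1)"
  shows "complex_of_real (profile m t) = cis (- (2 * m * t)) * poly (poly P23 (monom 1 n)) (cis (2 * t))"
proof -
  have "profile m t = 2 * cos (2 * m * t) + 2 * cos ((m + 1) * t) + 2 * cos ((m - 1) * t) + 1"
    using cos_double_cos[of "m * t"]
    by (simp add: profile_def cos_add cos_diff algebra_simps)
  then have "cis (2 * m * t) * complex_of_real (profile m t) =
      cis (2 * m * t) * complex_of_real (2 * cos (2 * m * t))
      + cis (2 * m * t) * complex_of_real (2 * cos ((m + 1) * t))
      + cis (2 * m * t) * complex_of_real (2 * cos ((m - 1) * t)) + cis (2 * m * t)"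
    by (simp add: algebra_simps)
  also have "\<dots> = poly (poly P23 (monom 1 n)) (cis (2 * t))"
    unfolding cis_mult_cos poly_P23_monom
    by (simp add: poly_monom Complex.DeMoivre m_def cis_mult algebra_simps)
  finally have "cis (- (2 * m * t)) * (cis (2 * m * t) * complex_of_real (profile m t)) =
     cis (- (2 * m * t)) * poly (poly P23 (monom 1 n)) (cis (2 * t))" by simp
  then show ?thesis by (simp add: mult.assoc[symmetric] cis_mult)
qed


text \<open>
  The two expressions are the first and second derivative of \<open>profile m\<close> at \<open>t\<close>: a root of order
  \<open>k\<close> of the polynomial makes the derivatives of the profile vanish up to order \<open>k - 1\<close>.
\<close>

lemma multiple_root_profile:
  fixes n :: nat and t :: real
  defines "m \<equiv> real (2 * n + 1)"
  defines "k \<equiv> order (cis (2 * t)) (poly P23 (monom 1 n))"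
  shows "k \<ge> 2 \<Longrightarrow>
      - 8 * m * cos (m * t) * sin (m * t) - 4 * sin t * cos (m * t) - 4 * m * cos t * sin (m * t) = 0"
      (is "_ \<Longrightarrow> ?f' t = 0")
    and "k \<ge> 3 \<Longrightarrow>
      - 8 * m\<^sup>2 * ((cos (m * t))\<^sup>2 - (sin (m * t))\<^sup>2) - 4 * cos t * cos (m * t)
      + 8 * m * sin t * sin (m * t) - 4 * m\<^sup>2 * cos t * cos (m * t) = 0"
      (is "_ \<Longrightarrow> ?f'' t = 0")
proof -
  define p where "p = poly P23 (monom 1 n)"
  define p1 where "p1 = angular_pderiv (of_real (2 * m)) p"
  define p2 where "p2 = angular_pderiv (of_real (2 * m)) p1"
  have d1: "(profile m has_real_derivative ?f' t) (at t)" for t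
    unfolding profile_def[abs_def]
    by (auto intro!: derivative_eq_intros simp: algebra_simps power2_eq_square)
  have d2: "(?f' has_real_derivative ?f'' t) (at t)" for t
    by (auto intro!: derivative_eq_intros simp: algebra_simps power2_eq_square)
  have e0: "complex_of_real (profile m t) = cis (- (2 * m * t)) * poly p (cis (2 * t))" for t
    unfolding m_def p_def by (rule poly_P23_cis)
  have e1: "complex_of_real (?f' t) = cis (- (2 * m * t)) * poly p1 (cis (2 * t))" for t
    unfolding p1_def by (rule angular_derivative[OF e0 d1])
  have e2: "complex_of_real (?f'' t) = cis (- (2 * m * t)) * poly p2 (cis (2 * t))" for t
    unfolding p2_def by (rule angular_derivative[OF e1 d2])
  have dvd: "[:- cis (2 * t), 1:] ^ j dvd p" if "j \<le> k" for j
    using that order_1[of "cis (2 * t)" p] unfolding k_def p_def[symmetric]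
    by (meson dvd_trans le_imp_power_dvd)
  show "?f' t = 0" if "k \<ge> 2"
  proof -
    have "[:- cis (2 * t), 1:] ^ 1 dvd p1"
      unfolding p1_def using dvd[of 2] that by (intro power_dvd_angular_pderiv) (simp add: numeral_2_eq_2)
    then have "poly p1 (cis (2 * t)) = 0" by (simp add: poly_eq_0_iff_dvd)
    then show ?thesis using e1[of t] by (metis mult_zero_right of_real_eq_0_iff)
  qed
  show "?f'' t = 0" if "k \<ge> 3"
  proof -
    have "[:- cis (2 * t), 1:] ^ 2 dvd p1"
      unfolding p1_def using dvd[of 3] that by (intro power_dvd_angular_pderiv) (simp add: numeral_3_eq_3)
    then have "[:- cis (2 * t), 1:] ^ 1 dvd p2"
      unfolding p2_def by (intro power_dvd_angular_pderiv) (simp add: numeral_2_eq_2)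
    then have "poly p2 (cis (2 * t)) = 0" by (simp add: poly_eq_0_iff_dvd)
    then show ?thesis using e2[of t] by (metis mult_zero_right of_real_eq_0_iff)
  qed
qed

section \<open>At most two zeros in each window\<close>

text \<open>
  The quotient \<open>K\<close> of the profile by \<open>- 4 cos (m t)\<close> is strictly convex in the window. Since
  this factor has no zero there, \<open>K\<close> and the profile have the same order of vanishing at each point,
  which the identities \<open>f0\<close>, \<open>f1\<close>, \<open>f2\<close> (Leibniz rule) make explicit up to order two.
\<close>

lemma sum_order_window_le_two:
  fixes n :: nat and k :: int
  defines "m \<equiv> real (2 * n + 1)"
  assumes "n > 0" and Z: "finite Z"
    "\<And>t. t \<in> Z \<Longrightarrow> \<bar>m * t - 2 * pi * of_int k\<bar> < pi / 2 \<and> profile m t = 0"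
  shows "(\<Sum>t\<in>Z. order (cis (2 * t)) (poly P23 (monom 1 n))) \<le> 2"
proof -
  have m: "m \<ge> 3" using \<open>n > 0\<close> unfolding m_def by simp
  define K where "K = (\<lambda>t. 1 / (4 * cos (m * t)) - cos (m * t) - cos t)"
  define K' where "K' = (\<lambda>t. m * sin (m * t) / (4 * (cos (m * t))\<^sup>2) + m * sin (m * t) + sin t)"
  define K'' where "K'' = (\<lambda>t. m\<^sup>2 * (1 / (4 * cos (m * t))
     + (sin (m * t))\<^sup>2 / (2 * cos (m * t) ^ 3) + cos (m * t)) + cos t)"
  define a where "a = (2 * pi * of_int k - pi / 2) / m"
  define b where "b = (2 * pi * of_int k + pi / 2) / m"
  have window: "t \<in> {a<..<b} \<longleftrightarrow> \<bar>m * t - 2 * pi * of_int k\<bar> < pi / 2" for t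
  proof -
    have "a < t \<longleftrightarrow> 2 * pi * of_int k - pi / 2 < m * t" "t < b \<longleftrightarrow> m * t < 2 * pi * of_int k + pi / 2"
      using m unfolding a_def b_def by (simp_all add: pos_divide_less_eq pos_less_divide_eq mult.commute)
    then show ?thesis unfolding greaterThanLessThan_iff by linarith
  qed
  have c: "cos (m * t) > 0" if "t \<in> {a<..<b}" for t
    using that unfolding window by (rule cos_window_pos)
  have f0: "profile m t = - 4 * cos (m * t) * K t" if "cos (m * t) \<noteq> 0" for t
    using that unfolding profile_def K_def by (simp add: field_simps power2_eq_square)
  have f1: "- 8 * m * cos (m * t) * sin (m * t) - 4 * sin t * cos (m * t) - 4 * m * cos t * sin (m * t)
    = - 4 * cos (m * t) * K' t + 4 * m * sin (m * t) * K t" if "cos (m * t) \<noteq> 0" for t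
    using that unfolding K'_def K_def
    by (simp add: divide_simps) (simp add: algebra_simps eval_nat_numeral)
  have f2: "- 8 * m\<^sup>2 * ((cos (m * t))\<^sup>2 - (sin (m * t))\<^sup>2) - 4 * cos t * cos (m * t)
      + 8 * m * sin t * sin (m * t) - 4 * m\<^sup>2 * cos t * cos (m * t)
    = - 4 * cos (m * t) * K'' t + 8 * m * sin (m * t) * K' t + 4 * m\<^sup>2 * cos (m * t) * K t"
    if "cos (m * t) \<noteq> 0" for t
    using that unfolding K''_def K'_def K_def
    by (simp add: divide_simps) (simp add: algebra_simps eval_nat_numeral)
  have pos: "K'' t > 0" if t: "t \<in> {a<..<b}" for t
  proof -
    define u where "u = cos (m * t)"
    have u: "u > 0" using c[OF t] unfolding u_def .
    \<comment> \<open>AM-GM: \<open>1 / (4 u) + u \<ge> 1\<close>, so the \<open>m\<^sup>2\<close>-part of \<open>K''\<close> outweighs \<open>cos t\<close>.\<close>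
    have "1 / (4 * u) + u - 1 = (2 * u - 1)\<^sup>2 / (4 * u)"
      using u by (simp add: field_simps power2_eq_square)
    also have "\<dots> \<ge> 0" using u by simp
    finally have "1 \<le> 1 / (4 * u) + (sin (m * t))\<^sup>2 / (2 * u ^ 3) + u"
      using u by (smt (verit) divide_nonneg_pos zero_le_power2 zero_less_power)
    moreover have "m\<^sup>2 \<ge> 9" using power_mono[of 3 m 2] m by simp
    ultimately have "9 * 1 \<le> m\<^sup>2 * (1 / (4 * u) + (sin (m * t))\<^sup>2 / (2 * u ^ 3) + u)"
      by (intro mult_mono) auto
    then show ?thesis unfolding K''_def u_def using cos_ge_minus_one[of t] by linarith
  qed
  show ?thesis
  proof (rule sum_le_two_of_convex[of a b K K' K''])
    fix t assume t: "t \<in> {a<..<b}"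
    have ne: "cos (m * t) \<noteq> 0" using c[OF t] by simp
    show "(K has_real_derivative K' t) (at t)"
      unfolding K_def K'_def using ne
      by (auto intro!: derivative_eq_intros simp: field_simps power2_eq_square)
    show "(K' has_real_derivative K'' t) (at t)"
    proof -
      have s: "((\<lambda>t. m * sin (m * t)) has_real_derivative m\<^sup>2 * cos (m * t)) (at t)"
        and c: "((\<lambda>t. 4 * (cos (m * t))\<^sup>2) has_real_derivative - 8 * m * cos (m * t) * sin (m * t)) (at t)"
        by (auto intro!: derivative_eq_intros simp: power2_eq_square)
      have "(m\<^sup>2 * u * (4 * u\<^sup>2) - m * v * (- 8 * m * u * v)) / (4 * u\<^sup>2 * (4 * u\<^sup>2))
          = m\<^sup>2 * (1 / (4 * u) + v\<^sup>2 / (2 * u ^ 3))" if "u \<noteq> 0" for u v :: real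
        using that by (simp add: divide_simps) (simp add: algebra_simps eval_nat_numeral)
      then have "((\<lambda>t. m * sin (m * t) / (4 * (cos (m * t))\<^sup>2)) has_real_derivative
          m\<^sup>2 * (1 / (4 * cos (m * t)) + (sin (m * t))\<^sup>2 / (2 * cos (m * t) ^ 3))) (at t)"
        using DERIV_divide[OF s c] ne by simp
      from DERIV_add[OF DERIV_add[OF this s] DERIV_sin] show ?thesis
        unfolding K'_def K''_def by (simp add: algebra_simps)
    qed
    show "K'' t > 0" by (rule pos[OF t])
  next
    show "finite Z" "Z \<subseteq> {a<..<b}" using Z window by auto
  next
    fix t assume t: "t \<in> Z"
    then have tab: "t \<in> {a<..<b}" using Z window by blast
    have ne: "cos (m * t) \<noteq> 0" using c[OF tab] by simp
    have "profile m t = 0" using Z(2)[OF t] by blast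
    then have "- 4 * cos (m * t) * K t = 0" unfolding f0[OF ne] .
    then show K0: "K t = 0" using ne by simp
    note mult = multiple_root_profile[of t n, folded m_def]
    have K'0: "K' t = 0" if "order (cis (2 * t)) (poly P23 (monom 1 n)) \<ge> 2"
    proof -
      from mult(1)[OF that] have "- 4 * cos (m * t) * K' t + 4 * m * sin (m * t) * K t = 0"
        unfolding f1[OF ne] .
      then show ?thesis unfolding K0 using ne by simp
    qed
    show "order (cis (2 * t)) (poly P23 (monom 1 n)) \<le> 1" if "K' t \<noteq> 0"
      using K'0 that by fastforce
    show "order (cis (2 * t)) (poly P23 (monom 1 n)) \<le> 2"
    proof (rule ccontr)
      assume "\<not> ?thesis"
      then have three: "order (cis (2 * t)) (poly P23 (monom 1 n)) \<ge> 3" by simp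
      then have K'0': "K' t = 0" by (intro K'0) simp
      from mult(2)[OF three] have "- 4 * cos (m * t) * K'' t + 8 * m * sin (m * t) * K' t
          + 4 * m\<^sup>2 * cos (m * t) * K t = 0"
        unfolding f2[OF ne] .
      then have "K'' t = 0" unfolding K0 K'0' using ne by simp
      then show False using pos[OF tab] by simp
    qed
  qed
qed

section \<open>Two zeros in the windows with a large cosine\<close>

text \<open>
  The sign \<open>e\<close> chooses the half of the window. At the centre \<open>cos (m t) = 1\<close> and the profile is
  \<open>3 + 4 cos t > 0\<close>, at the end \<open>cos (m t) = 0\<close> and it is \<open>-1\<close>.
\<close>

lemma profile_zero_exists:
  fixes m e :: real and k :: int
  assumes "m > 0" "e\<^sup>2 = 1" "cos (2 * pi * of_int k / m) > - 3 / 4"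
  obtains t where "profile m t = 0" "0 < e * (m * t - 2 * pi * of_int k)"
    "e * (m * t - 2 * pi * of_int k) < pi / 2"
proof -
  define g where "g = (\<lambda>s. (2 * pi * of_int k + e * s) / m)"
  have mg: "m * g s = 2 * pi * of_int k + e * s" for s
    using \<open>m > 0\<close> unfolding g_def by simp
  have e: "e = 1 \<or> e = - 1" using assms(2) by (simp add: power2_eq_1_iff)
  have cs: "cos (m * g s) = cos s" for s
    unfolding mg using e cos_int_2pin[of k] sin_int_2pin[of k] by (auto simp: cos_add cos_diff)
  have val: "profile m (g s) = 4 * (cos s)\<^sup>2 + 4 * cos (g s) * cos s - 1" for s
    unfolding profile_def cs ..
  have 0: "profile m (g 0) > 0" using assms(3) unfolding val by (simp add: g_def)
  have 1: "profile m (g (pi / 2)) < 0" unfolding val by simp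
  have "continuous_on {0..pi/2} (\<lambda>s. profile m (g s))"
    unfolding profile_def g_def using \<open>m > 0\<close> by (intro continuous_intros) auto
  then obtain s where s: "0 \<le> s" "s \<le> pi / 2" "profile m (g s) = 0"
    using IVT2'[of "\<lambda>s. profile m (g s)" "pi/2" 0 0] 0 1 by auto
  have "s \<noteq> 0" "s \<noteq> pi / 2" using s(3) 0 1 by force+
  moreover have "e * (m * g s - 2 * pi * of_int k) = s"
    unfolding mg using assms(2) by (simp add: power2_eq_square mult.assoc[symmetric])
  ultimately show ?thesis using that[of "g s"] s by simp
qed

section \<open>Unimodular roots as zeros with positive cosine\<close>

lemma cos_odd_mult_shift:
  fixes n :: nat
  defines "m \<equiv> real (2 * n + 1)"
  shows "cos (m * (t + pi)) = - cos (m * t)" "cos (m * (t - pi)) = - cos (m * t)"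
proof -
  show "cos (m * (t + pi)) = - cos (m * t)" for t
  proof -
    have "m * (t + pi) = m * t + pi + 2 * pi * real n" unfolding m_def by (simp add: algebra_simps)
    then show ?thesis using cos_2npi[of n] sin_2npi[of n]
      by (simp add: cos_add sin_add mult.commute mult.left_commute)
  qed
  from this[of "t - pi"] show "cos (m * (t - pi)) = - cos (m * t)" by simp
qed

text \<open>
  Of the two angles \<open>t\<close> modulo \<open>2 \<pi>\<close> with \<open>x = e\<^sup>2\<^sup>i\<^sup>t\<close>, which differ by \<open>\<pi>\<close>, exactly one has
  \<open>cos (m t) > 0\<close>, because \<open>m\<close> is odd and the cosine does not vanish at a zero of the profile.
\<close>

lemma unit_root_lift:
  fixes n :: nat
  defines "m \<equiv> real (2 * n + 1)"
  assumes "norm x = 1" "poly (poly P23 (monom 1 n)) x = 0"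
  obtains t where "x = cis (2 * t)" "\<bar>t\<bar> < pi" "cos (m * t) > 0" "profile m t = 0"
proof -
  have "x \<noteq> 0" using assms(2) by auto
  define s where "s = Arg x / 2"
  have x: "x = cis (2 * s)"
    using cis_Arg[OF \<open>x \<noteq> 0\<close>] assms(2) by (simp add: s_def sgn_div_norm)
  have s: "\<bar>s\<bar> \<le> pi / 2" using Arg_bounded[of x] unfolding s_def by (auto simp: abs_le_iff)
  have zero: "profile m u = 0" if "x = cis (2 * u)" for u
    using poly_P23_cis[of n u] assms(3) that unfolding m_def by simp
  have "cos (m * s) \<noteq> 0" using zero[OF x] unfolding profile_def by auto
  then consider "cos (m * s) > 0" | "cos (m * s) < 0" "s > 0" | "cos (m * s) < 0" "s < 0"
    by (metis cos_zero linorder_neqE_linordered_idom mult_zero_right zero_less_one)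
  then show ?thesis
  proof cases
    case 1
    moreover have "\<bar>s\<bar> < pi" using s pi_gt_zero by linarith
    ultimately show ?thesis using that[of s] x zero by blast
  next
    case 2
    have "x = cis (2 * (s - pi))" using x by (simp add: right_diff_distrib cis_divide[symmetric])
    moreover have "\<bar>s - pi\<bar> < pi" using s 2 pi_gt_zero by linarith
    ultimately show ?thesis
      using 2 that[of "s - pi"] zero s cos_odd_mult_shift[of n s, folded m_def] by auto
  next
    case 3
    have "x = cis (2 * (s + pi))" using x by (simp add: distrib_left cis_mult[symmetric])
    moreover have "\<bar>s + pi\<bar> < pi" using s 3 pi_gt_zero by linarith
    ultimately show ?thesis
      using 3 that[of "s + pi"] zero s cos_odd_mult_shift[of n s, folded m_def] by auto
  qed
qed

lemma unit_root_lift_unique: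
  fixes n :: nat
  defines "m \<equiv> real (2 * n + 1)"
  assumes "cis (2 * s) = cis (2 * t)" "\<bar>s\<bar> < pi" "\<bar>t\<bar> < pi" "cos (m * s) > 0" "cos (m * t) > 0"
  shows "s = t"
proof -
  have "cis (2 * s - 2 * t) = 1" using assms(2) by (simp add: cis_divide[symmetric])
  then have "cos (2 * s - 2 * t) = 1" by (metis cis.simps(1) one_complex.simps(1))
  then obtain j :: int where "2 * s - 2 * t = of_int j * 2 * pi"
    using cos_one_2pi_int by auto
  then have j: "s = t + of_int j * pi" by simp
  then have "\<bar>of_int j * pi\<bar> < 2 * pi" using assms(3,4) by linarith
  then have "\<bar>of_int j :: real\<bar> < 2" by (simp add: abs_mult)
  then have "j = 0 \<or> j = 1 \<or> j = -1" by linarith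
  then show ?thesis
    using j cos_odd_mult_shift[of n t, folded m_def] assms(5,6) by auto
qed


section \<open>Counting the unimodular roots\<close>

text \<open>
  Each root lies in a window, and a window containing a root has an index \<open>k\<close> with
  \<open>2 \<pi> \<bar>k\<bar> < m \<bar>t\<bar> + \<pi>/2 \<le> m arccos (-3/4) + \<pi>/2\<close>; every such window contributes at most two.
\<close>

lemma unit_root_count_upper:
  fixes n :: nat
  defines "m \<equiv> real (2 * n + 1)"
  assumes "n > 0"
  shows "(\<Sum>x | poly (poly P23 (monom 1 n)) x = 0 \<and> norm x = 1. order x (poly P23 (monom 1 n)))
    \<le> 2 * (m * arccos (- (3 / 4)) / pi) + 3"
proof -
  define p where "p = poly P23 (monom 1 n)"
  define \<beta> where "\<beta> = arccos (- (3 / 4) :: real)"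
  have \<beta>: "0 \<le> \<beta>" "\<beta> \<le> pi" "cos \<beta> = - (3 / 4)"
    unfolding \<beta>_def using arccos_lbound[of "- (3/4)"] arccos_ubound[of "- (3/4)"] by auto
  have m: "m > 0" unfolding m_def by simp
  have p0: "p \<noteq> 0" using degree_P23_monom[OF \<open>n > 0\<close>] unfolding p_def by auto
  define X where "X = {x. poly p x = 0 \<and> norm x = 1}"
  have finX: "finite X" unfolding X_def using poly_roots_finite[OF p0] by simp
  have "\<forall>x\<in>X. \<exists>t. x = cis (2 * t) \<and> \<bar>t\<bar> < pi \<and> cos (m * t) > 0 \<and> profile m t = 0"
    using unit_root_lift[of _ n, folded m_def p_def] unfolding X_def by blast
  then obtain \<theta> where \<theta>: "\<And>x. x \<in> X \<Longrightarrow> x = cis (2 * \<theta> x) \<and> \<bar>\<theta> x\<bar> < pi \<and>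
      cos (m * \<theta> x) > 0 \<and> profile m (\<theta> x) = 0"
    by metis
  define B where "B = m * \<beta> / (2 * pi) + 1 / 4"
  have "B > 0" unfolding B_def using m \<beta> by (simp add: add_nonneg_pos)
  define S where "S = {k::int. \<bar>of_int k\<bar> < B}"
  have "\<exists>k\<in>S. \<bar>m * \<theta> x - 2 * pi * of_int k\<bar> < pi / 2" if "x \<in> X" for x
  proof -
    define t where "t = \<theta> x"
    have t: "\<bar>t\<bar> < pi" "cos (m * t) > 0" "profile m t = 0" using \<theta>[OF that] unfolding t_def by auto
    obtain k :: int where k: "\<bar>m * t - 2 * pi * of_int k\<bar> < pi / 2"
      by (rule cos_pos_window[OF t(2)])
    define u where "u = cos (m * t)"
    have u: "0 < u" "u \<le> 1" "4 * u\<^sup>2 + 4 * cos t * u = 1"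
      using t(2,3) unfolding u_def profile_def by auto
    \<comment> \<open>\<open>cos t = 1/(4u) - u\<close> decreases in \<open>u\<close>, with value \<open>-3/4\<close> at \<open>u = 1\<close>.\<close>
    have "4 * u * (cos t + 3 / 4) = (1 - u) * (1 + 4 * u)"
      using u(3) by (simp add: algebra_simps power2_eq_square)
    moreover have "(1 - u) * (1 + 4 * u) \<ge> 0" using u by simp
    ultimately have "0 \<le> 4 * u * (cos t + 3 / 4)" by simp
    then have "0 \<le> cos t + 3 / 4" using u(1) unfolding zero_le_mult_iff by auto
    then have "cos t \<ge> - (3 / 4)" by simp
    then have "cos \<beta> \<le> cos \<bar>t\<bar>" using \<beta> by simp
    then have "\<bar>t\<bar> \<le> \<beta>" using \<beta> t(1) by (subst (asm) cos_mono_le_eq) auto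
    then have "m * \<bar>t\<bar> \<le> m * \<beta>" using m by simp
    moreover have "\<bar>m * t\<bar> = m * \<bar>t\<bar>" using m by (simp add: abs_mult)
    moreover have "\<bar>2 * pi * of_int k\<bar> = 2 * pi * \<bar>of_int k\<bar>" by (simp add: abs_mult)
    ultimately have "2 * pi * \<bar>of_int k\<bar> < m * \<beta> + pi / 2" using k by linarith
    then have "\<bar>of_int k\<bar> < B" unfolding B_def by (simp add: field_simps)
    then show ?thesis using k unfolding S_def t_def by blast
  qed
  then obtain \<kappa> where \<kappa>: "\<And>x. x \<in> X \<Longrightarrow> \<kappa> x \<in> S \<and> \<bar>m * \<theta> x - 2 * pi * of_int (\<kappa> x)\<bar> < pi / 2"
    by metis
  have finS: "finite S" unfolding S_def by (rule card_abs_less(1)[OF \<open>B > 0\<close>])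
  have "(\<Sum>x\<in>X. order x p) = (\<Sum>k\<in>S. \<Sum>x\<in>{x\<in>X. \<kappa> x = k}. order x p)"
    using \<kappa> by (intro sum.group[symmetric] finX finS) auto
  also have "\<dots> \<le> (\<Sum>k\<in>S. 2)"
  proof (rule sum_mono)
    fix k assume "k \<in> S"
    define Y where "Y = {x\<in>X. \<kappa> x = k}"
    have "inj_on \<theta> Y" using \<theta> unfolding Y_def by (metis (no_types, lifting) inj_onI mem_Collect_eq)
    then have "(\<Sum>t\<in>\<theta> ` Y. order (cis (2 * t)) p) = (\<Sum>x\<in>Y. order (cis (2 * \<theta> x)) p)"
      by (simp add: sum.reindex)
    also have "\<dots> = (\<Sum>x\<in>Y. order x p)"
      using \<theta> by (intro sum.cong) (auto simp: Y_def)
    finally have "(\<Sum>x\<in>Y. order x p) = (\<Sum>t\<in>\<theta> ` Y. order (cis (2 * t)) p)" ..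
    also have "\<dots> \<le> 2"
      unfolding p_def
      by (rule sum_order_window_le_two[OF \<open>n > 0\<close>, folded m_def, of _ k])
        (use \<theta> \<kappa> finX in \<open>auto simp: Y_def\<close>)
    finally show "(\<Sum>x\<in>{x\<in>X. \<kappa> x = k}. order x p) \<le> 2" unfolding Y_def .
  qed
  finally have "(\<Sum>x\<in>X. order x p) \<le> 2 * card S" by simp
  then have "real (\<Sum>x\<in>X. order x p) \<le> 2 * real (card S)" by linarith
  also have "\<dots> \<le> 2 * (2 * B + 1)"
    using card_abs_less(3)[OF \<open>B > 0\<close>] unfolding S_def by simp
  also have "\<dots> = 2 * (m * \<beta> / pi) + 3" unfolding B_def by simp
  finally show ?thesis unfolding X_def p_def \<beta>_def .
qed

text \<open>
  The windows with \<open>\<bar>2 \<pi> k / m\<bar> < arccos (-3/4)\<close> contain a zero in each half. These zeros give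
  distinct roots: the root determines \<open>t\<close>, the window of \<open>t\<close> determines \<open>k\<close>, and the side of the
  centre determines the half.
\<close>

lemma unit_root_count_lower:
  fixes n :: nat
  defines "m \<equiv> real (2 * n + 1)"
  assumes "n > 0"
  shows "2 * (m * arccos (- (3 / 4)) / pi) - 2 \<le>
    (\<Sum>x | poly (poly P23 (monom 1 n)) x = 0 \<and> norm x = 1. order x (poly P23 (monom 1 n)))"
proof -
  define p where "p = poly P23 (monom 1 n)"
  define \<beta> where "\<beta> = arccos (- (3 / 4) :: real)"
  have \<beta>: "0 < \<beta>" "\<beta> \<le> pi" "cos \<beta> = - (3 / 4)"
    unfolding \<beta>_def using arccos_lt_bounded[of "- (3/4)"] by auto
  have m: "m > 1" unfolding m_def using \<open>n > 0\<close> by simp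
  have p0: "p \<noteq> 0" using degree_P23_monom[OF \<open>n > 0\<close>] unfolding p_def by auto
  define X where "X = {x. poly p x = 0 \<and> norm x = 1}"
  have finX: "finite X" unfolding X_def using poly_roots_finite[OF p0] by simp
  define B where "B = m * \<beta> / (2 * pi)"
  have "B > 0" unfolding B_def using m \<beta> by simp
  define S where "S = {k::int. \<bar>of_int k\<bar> < B}"
  define E where "E = {1, - 1 :: real}"
  have "\<exists>t. profile m t = 0 \<and> 0 < e * (m * t - 2 * pi * of_int k) \<and>
      e * (m * t - 2 * pi * of_int k) < pi / 2" if "k \<in> S" "e \<in> E" for k e
  proof -
    have "\<bar>of_int k\<bar> < B" using that unfolding S_def by simp
    then have "\<bar>2 * pi * of_int k / m\<bar> < \<beta>"
      unfolding B_def using m by (simp add: field_simps abs_mult)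
    then have "cos \<beta> < cos \<bar>2 * pi * of_int k / m\<bar>" using \<beta> by (intro cos_monotone_0_pi) auto
    then have "cos (2 * pi * of_int k / m) > - 3 / 4"
      using \<beta>(3) cos_abs_real[of "2 * pi * of_int k / m"] by linarith
    moreover have "e\<^sup>2 = 1" using that unfolding E_def by auto
    ultimately show ?thesis using profile_zero_exists[of m e k] m by (metis less_trans zero_less_one)
  qed
  then obtain \<tau> where \<tau>: "\<And>k e. k \<in> S \<Longrightarrow> e \<in> E \<Longrightarrow> profile m (\<tau> k e) = 0 \<and>
      0 < e * (m * \<tau> k e - 2 * pi * of_int k) \<and> e * (m * \<tau> k e - 2 * pi * of_int k) < pi / 2"
    by metis
  have win: "\<bar>m * \<tau> k e - 2 * pi * of_int k\<bar> < pi / 2" if "k \<in> S" "e \<in> E" for k e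
    using \<tau>[OF that] that(2) unfolding E_def by auto
  \<comment> \<open>No window with index \<open>\<bar>k\<bar> \<le> n\<close> reaches \<open>\<plusminus>\<pi>\<close>, because \<open>2 n + 1/2 < m\<close>; so there is no wrap-around.\<close>
  have le: "\<bar>of_int k\<bar> \<le> real n" if "k \<in> S" for k
  proof -
    have "\<bar>of_int k\<bar> < m * \<beta> / (2 * pi)" using that unfolding S_def B_def by simp
    also have "\<dots> \<le> m * pi / (2 * pi)" using m \<beta> by (intro divide_right_mono mult_left_mono) auto
    also have "\<dots> = real n + 1 / 2" unfolding m_def by simp
    finally have "\<bar>k\<bar> < int n + 1" by linarith
    then show ?thesis by linarith
  qed
  have bound: "\<bar>\<tau> k e\<bar> < pi" if "k \<in> S" "e \<in> E" for k e
  proof -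
    have "2 * pi * \<bar>of_int k\<bar> \<le> 2 * pi * real n" using le[OF that(1)] by (intro mult_left_mono) auto
    then have "\<bar>m * \<tau> k e\<bar> < 2 * pi * real n + pi / 2"
      using win[OF that] abs_mult_pos'[of "2 * pi" "of_int k"] pi_ge_zero by linarith
    also have "\<dots> < m * pi" unfolding m_def by (simp add: algebra_simps)
    finally show ?thesis using m by (simp add: abs_mult)
  qed
  have inj: "inj_on (\<lambda>(k, e). cis (2 * \<tau> k e)) (S \<times> E)"
  proof (rule inj_onI, clarify)
    fix k e k' e' assume *: "k \<in> S" "e \<in> E" "k' \<in> S" "e' \<in> E" "cis (2 * \<tau> k e) = cis (2 * \<tau> k' e')"
    have eq: "\<tau> k e = \<tau> k' e'"
      using unit_root_lift_unique[of "\<tau> k e" "\<tau> k' e'" n, folded m_def] * bound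
        cos_window_pos[OF win] by blast
    have "\<bar>2 * pi * (of_int k - of_int k')\<bar> < pi"
      using win[OF *(1,2)] win[OF *(3,4)] unfolding eq right_diff_distrib by linarith
    then have "\<bar>of_int k - of_int k' :: real\<bar> < 1" by (simp add: abs_mult)
    then have k: "k = k'" by linarith
    moreover have "e = e'"
    proof -
      define d where "d = m * \<tau> k' e' - 2 * pi * of_int k'"
      have "0 < e * d" "0 < e' * d"
        using \<tau>[OF *(1,2)] \<tau>[OF *(3,4)] unfolding d_def eq unfolding k by blast+
      then show ?thesis using *(2,4) unfolding E_def by auto
    qed
    ultimately show "k = k' \<and> e = e'" by simp
  qed
  have sub: "(\<lambda>(k, e). cis (2 * \<tau> k e)) ` (S \<times> E) \<subseteq> X"
  proof clarify
    fix k e assume "k \<in> S" "e \<in> E"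
    then have "profile m (\<tau> k e) = 0" using \<tau> by blast
    then have "poly p (cis (2 * \<tau> k e)) = 0"
      using poly_P23_cis[of n "\<tau> k e", folded m_def p_def] by simp
    then show "cis (2 * \<tau> k e) \<in> X" unfolding X_def by simp
  qed
  have "2 * (m * \<beta> / pi) - 2 = 2 * (2 * B - 1)" unfolding B_def by simp
  also have "\<dots> \<le> 2 * real (card S)"
    using card_abs_less(2)[OF \<open>B > 0\<close>] unfolding S_def by simp
  also have "\<dots> = card (S \<times> E)" unfolding E_def by (simp add: card_cartesian_product)
  also have "\<dots> \<le> card X" using card_inj_on_le[OF inj sub finX] by simp
  also have "\<dots> = (\<Sum>x\<in>X. 1::nat)" by simp
  also have "real (\<Sum>x\<in>X. 1::nat) \<le> real (\<Sum>x\<in>X. order x p)"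
    unfolding of_nat_le_iff
    by (rule sum_mono) (use p0 in \<open>auto simp: X_def Suc_le_eq order_root\<close>)
  finally show ?thesis unfolding X_def p_def \<beta>_def .
qed

lemma off_circle_ratio_bound:
  assumes "n > 0"
  shows "\<bar>off_circle_ratio (poly P23 (monom 1 n)) - arccos (3 / 4) / pi\<bar> \<le> 1 / real n"
proof -
  define p where "p = poly P23 (monom 1 n)"
  define m where "m = real (2 * n + 1)"
  define U where "U = (\<Sum>x | poly p x = 0 \<and> norm x = 1. order x p)"
  have m: "m > 0" unfolding m_def by simp
  have deg: "degree p = 4 * n + 2" unfolding p_def by (rule degree_P23_monom[OF assms])
  then have "p \<noteq> 0" by auto
  from num_inside_outside_eq[OF this]
  have "real (num_inside p + num_outside p) = 2 * m - real U"
    unfolding deg U_def[symmetric] m_def by (simp flip: of_nat_add add: of_nat_diff)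
  then have ratio: "off_circle_ratio p = 1 - real U / (2 * m)"
    unfolding off_circle_ratio_def deg m_def by (simp add: field_simps)
  have "arccos (- (3 / 4)) = pi - arccos (3 / 4 :: real)" by (rule arccos_minus) auto
  then have q: "arccos (- (3 / 4)) / pi = 1 - arccos (3 / 4) / pi" by (simp add: diff_divide_distrib)
  define a where "a = arccos (3 / 4) / pi"
  have "real U \<le> 2 * (m * (1 - a)) + 3" "2 * (m * (1 - a)) - 2 \<le> real U"
    using unit_root_count_upper[OF assms] unit_root_count_lower[OF assms]
    unfolding U_def p_def m_def a_def q[symmetric] by simp_all
  then have "real U / (2 * m) \<le> (2 * (m * (1 - a)) + 3) / (2 * m)"
    "(2 * (m * (1 - a)) - 2) / (2 * m) \<le> real U / (2 * m)"
    using m by (simp_all add: divide_right_mono)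
  moreover have "(2 * (m * (1 - a)) + 3) / (2 * m) = 1 - a + 3 / (2 * m)"
    "(2 * (m * (1 - a)) - 2) / (2 * m) = 1 - a - 2 / (2 * m)"
    using m by (simp_all add: add_divide_distrib diff_divide_distrib)
  ultimately have "- 3 / (2 * m) \<le> off_circle_ratio p - a" "off_circle_ratio p - a \<le> 2 / (2 * m)"
    unfolding ratio by linarith+
  moreover have "3 / (2 * m) \<le> 1 / real n" "2 / (2 * m) \<le> 1 / real n"
    unfolding m_def using assms by (simp_all add: field_simps)
  ultimately show ?thesis unfolding p_def a_def by (simp add: abs_le_iff)
qed

theorem theorem1:
  shows "(\<lambda>n::nat. off_circle_ratio (poly P23 (monom 1 n))) \<longlonglongrightarrow> arccos (3 / 4) / pi"
proof (rule Lim_null_comparison[THEN LIM_zero_cancel])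
  show "\<forall>\<^sub>F n in sequentially.
      norm (off_circle_ratio (poly P23 (monom 1 n)) - arccos (3 / 4) / pi) \<le> 1 / real n"
    using eventually_gt_at_top[of 0] by eventually_elim (simp add: off_circle_ratio_bound)
  show "(\<lambda>n. 1 / real n) \<longlonglongrightarrow> 0" by (rule lim_1_over_n)
qed

end
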